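(* Let $k\ge2$ and $m\ge1$ be integers. (i) The spectrum of the normalized integrated Laplacian matrix of $K^M_{k(m)}$ is $0^{(1)}$, $(\frac{k}{k-1})^{(k-1)}$, $1^{(2mk-k)}$. (ii) The spectrum of the normalized integrated Laplacian matrix of $K^D_{k(m)}$ is $2^{(1)}$, $0^{(1)}$, $(\frac{k}{k-1})^{(k-1)}$, $(\frac{k-2}{k-1})^{(k-1)}$, $1^{(2km-2k)}$. Here $\lambda^{(t)}$ denotes an eigenvalue of multiplicity $t$.
   Context: A mixed graph has a finite vertex set, a multiset of edges (unordered pairs) and a multiset of arcs (ordered pairs). $K^M_{k(m)}$ is the mixed graph whose vertex set is partitioned into $k$ parts of size $m$, in which for every two vertices $u,v$ in different parts there is exactly one edge $\{u,v\}$, exactly one arc $(u,v)$ and exactly one arc $(v,u)$, and no other edges or arcs. $K^D_{k(m)}$ is the same but with no edges. For a vertex $v$: $d(v)$ is the number of edges at $v$ (loops counted twice), $d^+(v)$ (resp. $d^-(v)$) the number of arcs starting (resp. ending) at $v$, $l(v)$ the number of loops at $v$. For $V_G=\{v_1,\dots,v_n\}$, writing $d_i=d(v_i)$, $d_i^\pm=d^\pm(v_i)$, the normalized integrated Laplacian matrix $\mathcal{I}^{\mathcal{L}}(G)$ is the $2n\times 2n$ matrix indexed by $v'_1,\dots,v'_n,v''_1,\dots,v''_n$ with: $(v'_i,v'_i)$ entry $1-\frac{2l(v_i)}{d_i+d_i^+}$ if $d_i+d_i^+\ne0$ (else $0$); $(v''_i,v''_i)$ entry $1-\frac{2l(v_i)}{d_i+d_i^-}$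 if $d_i+d_i^-\neq0$ (else $0$); for $i\ne j$, $(v'_i,v'_j)$ entry $-\beta/\sqrt{(d_i+d_i^+)(d_j+d_j^+)}$ and $(v''_i,v''_j)$ entry $-\beta/\sqrt{(d_i+d_i^-)(d_j+d_j^-)}$, where $\beta$ is the number of edges joining $v_i,v_j$ (entries $0$ if $\beta=0$); and $(v'_i,v''_j)$ and $(v''_j,v'_i)$ entries $-\gamma/\sqrt{(d_i+d_i^+)(d_j+d_j^-)}$, where $\gamma$ is the number of arcs from $v_i$ to $v_j$ (entries $0$ if $\gamma=0$). *)

theory Defs
  imports
    Complex_Main
    "HOL-Library.Multiset"
    "HOL-Library.Uprod"
    "HOL-Library.Disjoint_Sets"
    "HOL-Computational_Algebra.Polynomial"
    "Jordan_Normal_Form.Char_Poly"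
begin

(* Unordered pairs are uprods, so that Upair v v is a loop. *)
record 'v mixed_graph =
  verts :: "'v set"
  edges :: "'v uprod multiset"
  arcs :: "('v \<times> 'v) multiset"

definition wf_mixed_graph :: "'v mixed_graph \<Rightarrow> bool" where
  "wf_mixed_graph G \<longleftrightarrow> finite (verts G)
     \<and> (\<forall>e \<in># edges G. set_uprod e \<subseteq> verts G)
     \<and> set_mset (arcs G) \<subseteq> verts G \<times> verts G"

definition num_loops :: "'v mixed_graph \<Rightarrow> 'v \<Rightarrow> nat" where
  "num_loops G v = count (edges G) (Upair v v)"

(* The filter counts every loop once; the second summand counts it again. *)
definition deg :: "'v mixed_graph \<Rightarrow> 'v \<Rightarrow> nat" where
  "deg G v = size {# e \<in># edges G. v \<in> set_uprod e #} + num_loops G v"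

definition out_deg :: "'v mixed_graph \<Rightarrow> 'v \<Rightarrow> nat" where
  "out_deg G v = size {# a \<in># arcs G. fst a = v #}"

definition in_deg :: "'v mixed_graph \<Rightarrow> 'v \<Rightarrow> nat" where
  "in_deg G v = size {# a \<in># arcs G. snd a = v #}"

(* Rows and columns are ordered v'_1, ..., v'_n, v''_1, ..., v''_n, where vs = [v_1, ..., v_n]
   enumerates the vertices (indices are shifted to start at 0). An off-diagonal entry without
   joining edges or arcs is 0, since its numerator is 0 and x / 0 = 0. *)
definition norm_int_laplacian :: "'v mixed_graph \<Rightarrow> 'v list \<Rightarrow> real mat" where
  "norm_int_laplacian G vs =
    (let n = length vs;
         dp = (\<lambda>i. real (deg G (vs ! i) + out_deg G (vs ! i)));
         dm = (\<lambda>i. real (deg G (vs ! i) + in_deg G (vs ! i)));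
         l = (\<lambda>i. real (num_loops G (vs ! i)));
         \<beta> = (\<lambda>i j. real (count (edges G) (Upair (vs ! i) (vs ! j))));
         \<gamma> = (\<lambda>i j. real (count (arcs G) (vs ! i, vs ! j)))
     in four_block_mat
          (mat n n (\<lambda>(i, j). if i = j then (if dp i \<noteq> 0 then 1 - 2 * l i / dp i else 0)
                              else - \<beta> i j / sqrt (dp i * dp j)))
          (mat n n (\<lambda>(i, j). - \<gamma> i j / sqrt (dp i * dm j)))
          (mat n n (\<lambda>(i, j). - \<gamma> j i / sqrt (dp j * dm i)))
          (mat n n (\<lambda>(i, j). if i = j then (if dm i \<noteq> 0 then 1 - 2 * l i / dm i else 0)
                              else - \<beta> i j / sqrt (dm i * dm j))))"

(* Eigenvalues with multiplicity. Over the reals this is the whole spectrum for symmetric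
   matrices, and norm_int_laplacian is symmetric. *)
definition eigenvalue_mset :: "'a :: idom mat \<Rightarrow> 'a multiset" where
  "eigenvalue_mset A = proots (char_poly A)"

definition equipartition :: "nat \<Rightarrow> nat \<Rightarrow> 'v set \<Rightarrow> 'v set set \<Rightarrow> bool" where
  "equipartition k m V P \<longleftrightarrow> partition_on V P \<and> card P = k \<and> (\<forall>X \<in> P. card X = m)"

definition different_parts :: "'v set set \<Rightarrow> 'v \<Rightarrow> 'v \<Rightarrow> bool" where
  "different_parts P u v \<longleftrightarrow> (\<exists>X \<in> P. \<exists>Y \<in> P. X \<noteq> Y \<and> u \<in> X \<and> v \<in> Y)"

definition is_KM :: "nat \<Rightarrow> nat \<Rightarrow> 'v mixed_graph \<Rightarrow> bool" where
  "is_KM k m G \<longleftrightarrow> wf_mixed_graph G \<and> (\<exists>P. equipartition k m (verts G) P \<and>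
     (\<forall>u \<in> verts G. \<forall>v \<in> verts G.
        count (edges G) (Upair u v) = (if different_parts P u v then 1 else 0) \<and>
        count (arcs G) (u, v) = (if different_parts P u v then 1 else 0)))"

definition is_KD :: "nat \<Rightarrow> nat \<Rightarrow> 'v mixed_graph \<Rightarrow> bool" where
  "is_KD k m G \<longleftrightarrow> wf_mixed_graph G \<and> edges G = {#} \<and> (\<exists>P. equipartition k m (verts G) P \<and>
     (\<forall>u \<in> verts G. \<forall>v \<in> verts G.
        count (arcs G) (u, v) = (if different_parts P u v then 1 else 0)))"

end

theory Submission
  imports Defs
begin

text \<open>All degrees are equal, so the characteristic matrix has the block form \<open>(X, Y; Y, X)\<close> and its
  determinant is \<open>det (X + Y) * det (X - Y)\<close>. Both factors have the form \<open>det (a I + b A)\<close>, where \<open>A\<close>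
  is the adjacency matrix of the complete multipartite graph. Writing \<open>A = E (J - I) E\<^sup>T\<close> with \<open>E\<close> the
  vertex-part incidence matrix and \<open>J\<close> the all-ones matrix, and using \<open>E\<^sup>T E = m I\<close>, Sylvester's
  determinant identity reduces this to the \<open>k\<close> by \<open>k\<close> determinant of \<open>(a - m b) I + m b J\<close>; a second
  application, to the rank-one matrix \<open>m b J\<close>, evaluates it.\<close>

section \<open>Determinant identities for block and low-rank matrices\<close>

text \<open>Multiplying the bordered matrix \<open>?M\<close> by \<open>?R\<close> on the right or
  by \<open>?L\<close> on the left clears its lower left block. The two resulting block triangular
  determinants give \<open>det ?M = det (a I + E F)\<close> and
  \<open>a ^ k * det ?M = a ^ n * det (a I + F E)\<close>. Keeping powers of \<open>a\<close> on
  both sides avoids division in the integral domain.\<close>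

lemma det_sylvester:
  fixes E :: "'a :: idom mat"
  assumes E: "E \<in> carrier_mat n k" and F: "F \<in> carrier_mat k n"
  shows "a ^ k * det (a \<cdot>\<^sub>m 1\<^sub>m n + E * F) = a ^ n * det (a \<cdot>\<^sub>m 1\<^sub>m k + F * E)"
proof -
  note cs = E F
  let ?M = "four_block_mat (a \<cdot>\<^sub>m 1\<^sub>m n) E (- F) (1\<^sub>m k)"
  let ?R = "four_block_mat (1\<^sub>m n) (0\<^sub>m n k) F (1\<^sub>m k)"
  let ?L = "four_block_mat (1\<^sub>m n) (0\<^sub>m n k) F (a \<cdot>\<^sub>m 1\<^sub>m k)"
  have M: "?M \<in> carrier_mat (n + k) (n + k)" "?R \<in> carrier_mat (n + k) (n + k)"
    "?L \<in> carrier_mat (n + k) (n + k)"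
    using cs by auto
  have neg: "- F + F = 0\<^sub>m k n"
    using F by auto
  have "?M * ?R = four_block_mat (a \<cdot>\<^sub>m 1\<^sub>m n + E * F) E (0\<^sub>m k n) (1\<^sub>m k)"
    by (subst mult_four_block_mat[where ?nr1.0 = n and ?n1.0 = n and ?n2.0 = k and ?nr2.0 = k
          and ?nc1.0 = n and ?nc2.0 = k], use cs neg in auto)
  moreover have "det ?R = 1"
    by (subst det_four_block_mat_upper_right_zero[OF _ refl], use cs in auto)
  moreover have "det (four_block_mat (a \<cdot>\<^sub>m 1\<^sub>m n + E * F) E (0\<^sub>m k n) (1\<^sub>m k))
      = det (a \<cdot>\<^sub>m 1\<^sub>m n + E * F)"
    by (subst det_four_block_mat_lower_left_zero[OF _ _ refl], use cs in auto)
  ultimately have 1: "det ?M = det (a \<cdot>\<^sub>m 1\<^sub>m n + E * F)"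
    using det_mult[OF M(1,2)] by simp
  have aF: "F * (a \<cdot>\<^sub>m 1\<^sub>m n) + (a \<cdot>\<^sub>m 1\<^sub>m k) * (- F) = 0\<^sub>m k n"
  proof -
    have "F * (a \<cdot>\<^sub>m 1\<^sub>m n) = a \<cdot>\<^sub>m F"
      using F by (simp add: mult_smult_distrib[of _ k n _ n])
    moreover have "(a \<cdot>\<^sub>m 1\<^sub>m k) * (- F) = a \<cdot>\<^sub>m (- F)"
      using F by (subst mult_smult_assoc_mat[of _ k k _ n]) auto
    ultimately show ?thesis
      using F by auto
  qed
  have "?L * ?M = four_block_mat (a \<cdot>\<^sub>m 1\<^sub>m n) E (0\<^sub>m k n) (F * E + a \<cdot>\<^sub>m 1\<^sub>m k)"
    by (subst mult_four_block_mat[where ?nr1.0 = n and ?n1.0 = n and ?n2.0 = k and ?nr2.0 = k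
          and ?nc1.0 = n and ?nc2.0 = k], use cs aF in auto)
  moreover have "det ?L = a ^ k"
    by (subst det_four_block_mat_upper_right_zero[OF _ refl], use cs in auto)
  moreover have "F * E + a \<cdot>\<^sub>m 1\<^sub>m k = a \<cdot>\<^sub>m 1\<^sub>m k + F * E"
    using cs by (intro comm_add_mat) auto
  moreover have "det (four_block_mat (a \<cdot>\<^sub>m 1\<^sub>m n) E (0\<^sub>m k n) (a \<cdot>\<^sub>m 1\<^sub>m k + F * E))
      = a ^ n * det (a \<cdot>\<^sub>m 1\<^sub>m k + F * E)"
    by (subst det_four_block_mat_lower_left_zero[OF _ _ refl], use cs in auto)
  ultimately show ?thesis
    using 1 det_mult[OF M(3,1)] by simp
qed

text \<open>\<open>?L\<close> adds the second block row to the first and \<open>?R\<close> subtracts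
  the first block column from the second. Both have determinant 1, and the result is block lower
  triangular with diagonal blocks \<open>X + Y\<close> and \<open>X - Y\<close>.\<close>

lemma det_four_block_mat_symmetric:
  fixes X :: "'a :: idom mat"
  assumes X: "X \<in> carrier_mat n n" and Y: "Y \<in> carrier_mat n n"
  shows "det (four_block_mat X Y Y X) = det (X + Y) * det (X - Y)"
proof -
  let ?M = "four_block_mat X Y Y X"
  let ?L = "four_block_mat (1\<^sub>m n) (1\<^sub>m n) (0\<^sub>m n n) (1\<^sub>m n :: 'a mat)"
  let ?R = "four_block_mat (1\<^sub>m n) (- 1\<^sub>m n) (0\<^sub>m n n) (1\<^sub>m n :: 'a mat)"
  have M: "?M \<in> carrier_mat (n + n) (n + n)" "?L \<in> carrier_mat (n + n) (n + n)"
    "?R \<in> carrier_mat (n + n) (n + n)"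
    using X Y by auto
  have "Y + X = X + Y"
    using X Y by (intro comm_add_mat) auto
  then have LM: "?L * ?M = four_block_mat (X + Y) (X + Y) Y X"
    by (subst mult_four_block_mat[where ?nr1.0 = n and ?n1.0 = n and ?n2.0 = n and ?nr2.0 = n
          and ?nc1.0 = n and ?nc2.0 = n], use X Y in auto)
  have "- (X + Y) + (X + Y) = 0\<^sub>m n n" "- Y + X = X - Y"
    using X Y by auto
  then have "four_block_mat (X + Y) (X + Y) Y X * ?R
      = four_block_mat (X + Y) (0\<^sub>m n n) Y (X - Y)"
    by (subst mult_four_block_mat[where ?nr1.0 = n and ?n1.0 = n and ?n2.0 = n and ?nr2.0 = n
          and ?nc1.0 = n and ?nc2.0 = n], use X Y in auto)
  with LM have LMR: "?L * ?M * ?R = four_block_mat (X + Y) (0\<^sub>m n n) Y (X - Y)"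
    by simp
  have "det (?L * ?M * ?R) = det ?L * det ?M * det ?R"
    using det_mult[OF mult_carrier_mat[OF M(2,1)] M(3)] det_mult[OF M(2,1)] by simp
  moreover have "det ?L = 1" "det ?R = 1"
    by (subst det_four_block_mat_lower_left_zero[OF _ _ refl]; auto)+
  moreover have "det (four_block_mat (X + Y) (0\<^sub>m n n) Y (X - Y)) = det (X + Y) * det (X - Y)"
    by (rule det_four_block_mat_upper_right_zero, use X Y in auto)
  ultimately show ?thesis
    using LMR by simp
qed

text \<open>The matrix is \<open>c I\<close> plus a column of ones times a row of entries
  \<open>d\<close>, so Sylvester's identity leaves a 1 by 1 determinant. Cancelling one factor
  \<open>c\<close> uses \<open>c \<noteq> 0\<close>.\<close>

lemma det_const_plus_diag:
  fixes c d :: "'a :: idom"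
  assumes "c \<noteq> 0" and "k \<ge> 1"
  shows "det (mat k k (\<lambda>(i, j). if i = j then c + d else d)) = c ^ (k - 1) * (c + of_nat k * d)"
proof -
  let ?E = "mat k 1 (\<lambda>_. 1 :: 'a)" and ?F = "mat 1 k (\<lambda>_. d)"
  have "c ^ 1 * det (c \<cdot>\<^sub>m 1\<^sub>m k + ?E * ?F) = c ^ k * det (c \<cdot>\<^sub>m 1\<^sub>m 1 + ?F * ?E)"
    by (rule det_sylvester) auto
  moreover have "c \<cdot>\<^sub>m 1\<^sub>m k + ?E * ?F = mat k k (\<lambda>(i, j). if i = j then c + d else d)"
    by (rule eq_matI) (auto simp: scalar_prod_def)
  moreover have "det (c \<cdot>\<^sub>m 1\<^sub>m 1 + ?F * ?E) = c + of_nat k * d"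
    by (subst det_single) (auto simp: scalar_prod_def)
  moreover have "c ^ k = c * c ^ (k - 1)"
    using assms(2) by (cases k) auto
  ultimately show ?thesis
    using assms(1) by (simp add: mult.assoc)
qed

text \<open>This is \<open>a I + b A\<close> for the complete multipartite graph whose parts are the
  fibres of \<open>f\<close>. The entry type is general because both the real Laplacian blocks and
  the polynomial blocks of its characteristic matrix have this form.\<close>

definition multipartite_mat :: "nat \<Rightarrow> (nat \<Rightarrow> nat) \<Rightarrow> 'a :: zero \<Rightarrow> 'a \<Rightarrow> 'a mat" where
  "multipartite_mat n f a b = mat n n (\<lambda>(i, j). if i = j then a else if f i \<noteq> f j then b else 0)"

text \<open>With the factor \<open>b (J - I)\<close> absorbed into \<open>?F\<close>, the product
  \<open>?E * ?F\<close> is \<open>b A\<close> and \<open>?F * ?E\<close> is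
  \<open>m b (J - I)\<close>. Nonzero \<open>a\<close> lets \<open>a ^ k\<close> be cancelled;
  nonzero \<open>a - m b\<close> is what \<open>det_const_plus_diag\<close> asks for.\<close>

lemma det_multipartite_mat:
  fixes a b :: "'a :: idom"
  assumes f: "\<And>i. i < n \<Longrightarrow> f i < k"
    and fibre: "\<And>p. p < k \<Longrightarrow> card {i \<in> {0..<n}. f i = p} = m"
    and "k \<ge> 1" and "n = k * m" and "m \<ge> 1"
    and "a \<noteq> 0" and "a - of_nat m * b \<noteq> 0"
  shows "det (multipartite_mat n f a b)
    = a ^ (n - k) * (a - of_nat m * b) ^ (k - 1) * (a + (of_nat k - 1) * of_nat m * b)"
proof -
  let ?E = "mat n k (\<lambda>(i, p). if f i = p then 1 else 0 :: 'a)"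
  let ?F = "mat k n (\<lambda>(p, j). if p \<noteq> f j then b else 0)"
  have 1: "a ^ k * det (a \<cdot>\<^sub>m 1\<^sub>m n + ?E * ?F) = a ^ n * det (a \<cdot>\<^sub>m 1\<^sub>m k + ?F * ?E)"
    by (rule det_sylvester) auto
  have "(\<Sum>p = 0..<k. (if f i = p then 1 else 0) * (if p \<noteq> f j then b else 0))
      = (if f i \<noteq> f j then b else 0)" if "i < n" for i j
    using f[OF that] by (simp add: if_distrib[of "\<lambda>x. x * _"] sum.delta cong: if_cong)
  then have 2: "a \<cdot>\<^sub>m 1\<^sub>m n + ?E * ?F = multipartite_mat n f a b"
    by (intro eq_matI) (auto simp: scalar_prod_def multipartite_mat_def)
  \<comment> \<open>Column \<open>q\<close> of \<open>?E\<close> selects the \<open>m\<close>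
    indices of colour \<open>q\<close>; in row \<open>p\<close> of \<open>?F\<close> each of them
    carries \<open>b\<close> unless \<open>p = q\<close>.\<close>
  have "(\<Sum>j = 0..<n. (if p \<noteq> f j then b else 0) * (if f j = q then 1 else 0))
      = (if p = q then 0 else of_nat m * b)" if "q < k" for p q
  proof -
    have "(\<Sum>j = 0..<n. (if p \<noteq> f j then b else 0) * (if f j = q then 1 else 0))
        = (\<Sum>j = 0..<n. if f j = q then (if p = q then 0 else b) else 0)"
      by (intro sum.cong) auto
    also have "\<dots> = (\<Sum>j \<in> {j \<in> {0..<n}. f j = q}. if p = q then 0 else b)"
      by (subst sum.inter_filter) auto
    finally show ?thesis
      using fibre[OF that] by simp
  qed
  then have 3: "a \<cdot>\<^sub>m 1\<^sub>m k + ?F * ?E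
      = mat k k (\<lambda>(i, j). if i = j then (a - of_nat m * b) + of_nat m * b else of_nat m * b)"
    by (intro eq_matI) (auto simp: scalar_prod_def)
  have "k \<le> n"
    using \<open>n = k * m\<close> \<open>m \<ge> 1\<close> by simp
  then have 4: "a ^ n = a ^ k * a ^ (n - k)"
    by (simp flip: power_add)
  have 5: "a - of_nat m * b + of_nat k * (of_nat m * b) = a + (of_nat k - 1) * of_nat m * b"
    by (simp add: algebra_simps)
  show ?thesis
    using 1 \<open>a \<noteq> 0\<close> unfolding 2 3 4 det_const_plus_diag[OF assms(7) \<open>k \<ge> 1\<close>] 5
    by (simp add: mult.assoc)
qed

section \<open>Counting incidences and colouring the parts\<close>

text \<open>Degrees are sizes of filtered multisets, whereas the graphs are given by multiplicities
  of pairs. The bridge is an injective parametrization \<open>g\<close> of the incident edges or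
  arcs by their other endpoint.\<close>

lemma size_filter_mset_reindex:
  assumes "finite V" and "inj_on g V" and "\<And>e. e \<in># M \<Longrightarrow> Q e \<longleftrightarrow> e \<in> g ` V"
  shows "size (filter_mset Q M) = (\<Sum>v\<in>V. count M (g v))"
proof -
  have "filter_mset Q M = filter_mset (\<lambda>e. e \<in> g ` V) M"
    using assms(3) by (intro filter_mset_cong) auto
  then have "size (filter_mset Q M)
      = (\<Sum>e \<in> set_mset M \<inter> g ` V. count M e)"
    by (auto simp: size_multiset_overloaded_eq intro!: sum.cong)
  also have "\<dots> = (\<Sum>e \<in> g ` V. count M e)"
    using assms(1) by (intro sum.mono_neutral_left) (auto simp: not_in_iff)
  also have "\<dots> = (\<Sum>v\<in>V. count M (g v))"
    using assms(2) by (simp add: sum.reindex)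
  finally show ?thesis .
qed

text \<open>Numbering the parts by a bijection \<open>h\<close> and sending each vertex to the
  number of its part yields the colouring that \<open>multipartite_mat\<close> expects.\<close>

lemma equipartition_colouring:
  assumes "equipartition k m V P" and "finite V"
  obtains c where "\<And>v. v \<in> V \<Longrightarrow> c v < k"
    and "\<And>p. p < k \<Longrightarrow> card {v \<in> V. c v = p} = m"
    and "\<And>u v. u \<in> V \<Longrightarrow> v \<in> V \<Longrightarrow> different_parts P u v \<longleftrightarrow> c u \<noteq> c v"
proof -
  from assms(1) have P: "partition_on V P" "card P = k" "\<And>X. X \<in> P \<Longrightarrow> card X = m"
    by (auto simp: equipartition_def)
  have "finite P"
    using P(1) assms(2) by (simp add: finite_elements)
  then obtain h where h: "bij_betw h P {0..<k}"
    using P(2) ex_bij_betw_finite_nat by blast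
  have V: "V = \<Union>P"
    using P(1) by (rule partition_onD1)
  have uniq: "X = Y" if "X \<in> P" "Y \<in> P" "v \<in> X" "v \<in> Y" for X Y v
    using partition_onD2[OF P(1)] that by (auto simp: disjoint_def)
  define part where "part v = (THE X. X \<in> P \<and> v \<in> X)" for v
  have part_eq: "part v = X" if "X \<in> P" "v \<in> X" for v X
    unfolding part_def using that uniq by (intro the_equality) auto
  have part: "part v \<in> P" "v \<in> part v" if "v \<in> V" for v
    using that part_eq V by auto
  show thesis
  proof
    show "(h \<circ> part) v < k" if "v \<in> V" for v
      using part(1)[OF that] bij_betwE[OF h] by auto
  next
    fix p assume "p < k"
    then have "p \<in> h ` P"
      using bij_betw_imp_surj_on[OF h] by simp
    then obtain X where X: "X \<in> P" "h X = p"
      by blast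
    have "{v \<in> V. (h \<circ> part) v = p} = X"
    proof (intro equalityI subsetI)
      fix v assume "v \<in> {v \<in> V. (h \<circ> part) v = p}"
      then have "v \<in> V" "h (part v) = h X"
        using X(2) by auto
      then show "v \<in> X"
        using part[of v] X(1) inj_onD[OF bij_betw_imp_inj_on[OF h]] by blast
    next
      fix v assume "v \<in> X"
      then show "v \<in> {v \<in> V. (h \<circ> part) v = p}"
        using X part_eq V by auto
    qed
    then show "card {v \<in> V. (h \<circ> part) v = p} = m"
      using P(3) X(1) by simp
  next
    fix u v assume uv: "u \<in> V" "v \<in> V"
    \<comment> \<open>Parts are disjoint, so the witnesses in \<open>different_parts\<close> can
      only be \<open>part u\<close> and \<open>part v\<close>.\<close>
    have "different_parts P u v \<longleftrightarrow> part u \<noteq> part v"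
      unfolding different_parts_def using part[OF uv(1)] part[OF uv(2)] part_eq by metis
    then show "different_parts P u v \<longleftrightarrow> (h \<circ> part) u \<noteq> (h \<circ> part) v"
      using part uv bij_betw_imp_inj_on[OF h] by (auto dest: inj_onD)
  qed
qed

text \<open>Both graphs are the case \<open>\<epsilon> \<in> {0, 1}\<close> of a complete multipartite mixed graph in which every
  edge has multiplicity \<open>\<epsilon>\<close>.\<close>

lemma eigenvalue_mset_multipartite_laplacian:
  fixes k m \<epsilon> :: nat and G :: "'v mixed_graph" and vs :: "'v list"
  defines "r \<equiv> (real \<epsilon> - 1) / (real \<epsilon> + 1)"
  assumes "k \<ge> 2" and "m \<ge> 1" and "distinct vs" and vs: "set vs = verts G"
    and wf: "wf_mixed_graph G" and part: "equipartition k m (verts G) P"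
    and edges: "\<And>u v. u \<in> verts G \<Longrightarrow> v \<in> verts G \<Longrightarrow>
      count (edges G) (Upair u v) = (if different_parts P u v then \<epsilon> else 0)"
    and arcs: "\<And>u v. u \<in> verts G \<Longrightarrow> v \<in> verts G \<Longrightarrow>
      count (arcs G) (u, v) = (if different_parts P u v then 1 else 0)"
  shows "eigenvalue_mset (norm_int_laplacian G vs) =
    (replicate_mset (k * m - k) 1 + replicate_mset (k - 1) (real k / (real k - 1)) + {# 0 #}) +
    (replicate_mset (k * m - k) 1 + replicate_mset (k - 1) (1 + r / (real k - 1)) + {# 1 - r #})"
proof -
  have fin: "finite (verts G)"
    using wf by (simp add: wf_mixed_graph_def)
  obtain c where c: "\<And>v. v \<in> verts G \<Longrightarrow> c v < k"
    and fibre: "\<And>p. p < k \<Longrightarrow> card {v \<in> verts G. c v = p} = m"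
    and diff: "\<And>u v. u \<in> verts G \<Longrightarrow> v \<in> verts G \<Longrightarrow> different_parts P u v \<longleftrightarrow> c u \<noteq> c v"
    using equipartition_colouring[OF part fin] by blast
  have P: "partition_on (verts G) P"
    using part by (simp add: equipartition_def)
  have "card (verts G) = (\<Sum>X\<in>P. card X)"
    using partition_onD1[OF P] fin by (intro product_partition[OF P]) (auto intro: finite_subset)
  also have "\<dots> = k * m"
    using part by (simp add: equipartition_def)
  finally have cardV: "card (verts G) = k * m" .
  define n where "n = length vs"
  have n: "n = k * m"
    unfolding n_def using cardV vs \<open>distinct vs\<close> distinct_card by metis
  define f where "f i = c (vs ! i)" for i
  have vi: "vs ! i \<in> verts G" if "i < n" for i
    using nth_mem[of i vs] that unfolding vs n_def by simp
  have f: "f i < k" if "i < n" for i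
    using c[OF vi[OF that]] by (simp add: f_def)
  \<comment> \<open>Fibre sizes carry over from vertices to indices because \<open>vs\<close> is a
    repetition-free enumeration.\<close>
  have f_fibre: "card {i \<in> {0..<n}. f i = p} = m" if "p < k" for p
  proof -
    have inj: "inj_on ((!) vs) {i \<in> {0..<n}. f i = p}"
      by (rule inj_on_nth[OF \<open>distinct vs\<close>]) (simp add: n_def)
    have image: "(!) vs ` {i \<in> {0..<n}. f i = p} = {v \<in> verts G. c v = p}"
    proof (intro equalityI subsetI)
      fix v assume "v \<in> {v \<in> verts G. c v = p}"
      then have "v \<in> set vs" "c v = p"
        using vs by simp_all
      then obtain i where "i < n" "vs ! i = v" "f i = p"
        unfolding n_def f_def in_set_conv_nth by blast
      then show "v \<in> (!) vs ` {i \<in> {0..<n}. f i = p}"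
        by force
    qed (use vi in \<open>auto simp: f_def\<close>)
    show ?thesis
      using card_image[OF inj] fibre[OF that] unfolding image by simp
  qed
  have others: "card {u \<in> verts G. c u \<noteq> c v} = (k - 1) * m" if "v \<in> verts G" for v
  proof -
    have "{u \<in> verts G. c u \<noteq> c v} = verts G - {u \<in> verts G. c u = c v}"
      by auto
    then show ?thesis
      using fin fibre[OF c[OF that]] cardV
      by (simp add: card_Diff_subset diff_mult_distrib)
  qed
  have loops: "num_loops G v = 0" if "v \<in> verts G" for v
    using edges[OF that that] diff[OF that that] by (simp add: num_loops_def)
  have deg: "deg G v = \<epsilon> * ((k - 1) * m)" if v: "v \<in> verts G" for v
  proof -
    \<comment> \<open>By well-formedness the other endpoint of an edge at \<open>v\<close> is a
      vertex, so \<open>Upair v\<close> reaches every such edge.\<close>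
    have "size {# e \<in># edges G. v \<in> set_uprod e #} = (\<Sum>u\<in>verts G. count (edges G) (Upair v u))"
    proof (rule size_filter_mset_reindex[OF fin])
      fix e assume e: "e \<in># edges G"
      then have "set_uprod e \<subseteq> verts G"
        using wf by (simp add: wf_mixed_graph_def)
      then show "v \<in> set_uprod e \<longleftrightarrow> e \<in> Upair v ` verts G"
        by (cases e) auto
    qed (auto simp: inj_on_def)
    also have "\<dots> = (\<Sum>u\<in>verts G. if c u \<noteq> c v then \<epsilon> else 0)"
      using v by (intro sum.cong) (auto simp: edges diff)
    also have "\<dots> = \<epsilon> * ((k - 1) * m)"
      using others[OF v] fin by (simp flip: sum.inter_filter)
    finally show ?thesis
      using loops[OF v] by (simp add: deg_def)
  qed
  have out_deg: "out_deg G v = (k - 1) * m" if v: "v \<in> verts G" for v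
  proof -
    have "out_deg G v = (\<Sum>u\<in>verts G. count (arcs G) (v, u))"
      unfolding out_deg_def
      using wf by (intro size_filter_mset_reindex[OF fin])
        (fastforce simp: inj_on_def wf_mixed_graph_def)+
    also have "\<dots> = (\<Sum>u\<in>verts G. if c u \<noteq> c v then 1 else 0)"
      using v by (intro sum.cong) (auto simp: arcs diff)
    also have "\<dots> = (k - 1) * m"
      using others[OF v] fin by (simp flip: sum.inter_filter)
    finally show ?thesis .
  qed
  have in_deg: "in_deg G v = (k - 1) * m" if v: "v \<in> verts G" for v
  proof -
    have "in_deg G v = (\<Sum>u\<in>verts G. count (arcs G) (u, v))"
      unfolding in_deg_def
      using wf by (intro size_filter_mset_reindex[OF fin])
        (fastforce simp: inj_on_def wf_mixed_graph_def)+
    also have "\<dots> = (\<Sum>u\<in>verts G. if c u \<noteq> c v then 1 else 0)"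
      using v by (intro sum.cong) (auto simp: arcs diff)
    also have "\<dots> = (k - 1) * m"
      using others[OF v] fin by (simp flip: sum.inter_filter)
    finally show ?thesis .
  qed

  \<comment> \<open>The Laplacian and its characteristic polynomial\<close>
  \<comment> \<open>\<open>s\<close> counts the vertices outside a fixed part; \<open>D\<close> is
    the common value of degree plus out-degree and of degree plus in-degree.\<close>
  define s where "s = (real k - 1) * real m"
  define D where "D = (real \<epsilon> + 1) * s"
  have s: "s > 0"
    using \<open>k \<ge> 2\<close> \<open>m \<ge> 1\<close> by (simp add: s_def)
  have real_s: "real ((k - 1) * m) = s"
    using \<open>k \<ge> 2\<close> by (simp add: s_def of_nat_diff)
  from s have D: "D > 0"
    by (simp add: D_def)
  have degs: "real (deg G (vs ! i) + out_deg G (vs ! i)) = D"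
    "real (deg G (vs ! i) + in_deg G (vs ! i)) = D" if "i < n" for i
    unfolding deg[OF vi[OF that]] out_deg[OF vi[OF that]] in_deg[OF vi[OF that]]
      of_nat_add of_nat_mult[of \<epsilon>] real_s
    by (simp_all add: D_def algebra_simps)
  \<comment> \<open>Every denominator is \<open>sqrt (D * D) = D\<close>. Arcs run in both
    directions with equal multiplicity, so the two off-diagonal blocks coincide.\<close>
  have L: "norm_int_laplacian G vs = four_block_mat
      (multipartite_mat n f 1 (- real \<epsilon> / D)) (multipartite_mat n f 0 (- 1 / D))
      (multipartite_mat n f 0 (- 1 / D)) (multipartite_mat n f 1 (- real \<epsilon> / D))"
  proof -
    have "sqrt (D * D) = D"
      using D by simp
    then show ?thesis
      unfolding norm_int_laplacian_def Let_def n_def[symmetric] multipartite_mat_def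
      using D
      by (intro arg_cong4[where f = four_block_mat] cong_mat refl)
        (auto simp: degs[unfolded of_nat_add] vi loops edges arcs diff f_def)
  qed
  \<comment> \<open>These are the blocks of \<open>x I - L\<close>: off-diagonal signs are reversed
    and \<open>[:-1, 1:]\<close> is \<open>x - 1\<close>.\<close>
  let ?X = "multipartite_mat n f [:-1, 1:] [:real \<epsilon> / D:]"
  let ?Y = "multipartite_mat n f 0 [:1 / D:]"
  have "char_poly_matrix (norm_int_laplacian G vs) = four_block_mat ?X ?Y ?Y ?X"
    unfolding L
  proof (rule eq_matI)
    fix i j assume "i < dim_row (four_block_mat ?X ?Y ?Y ?X)" "j < dim_col (four_block_mat ?X ?Y ?Y ?X)"
    then have "i < n + n" "j < n + n"
      by (simp_all add: multipartite_mat_def)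
    then show "char_poly_matrix (four_block_mat
        (multipartite_mat n f 1 (- real \<epsilon> / D)) (multipartite_mat n f 0 (- 1 / D))
        (multipartite_mat n f 0 (- 1 / D)) (multipartite_mat n f 1 (- real \<epsilon> / D))) $$ (i, j)
        = four_block_mat ?X ?Y ?Y ?X $$ (i, j)"
      by (cases "i < n"; cases "j < n") (auto simp: char_poly_matrix_def multipartite_mat_def)
  qed (simp_all add: char_poly_matrix_def multipartite_mat_def)
  moreover have "?X \<in> carrier_mat n n" "?Y \<in> carrier_mat n n"
    by (simp_all add: multipartite_mat_def)
  ultimately have "char_poly (norm_int_laplacian G vs) = det (?X + ?Y) * det (?X - ?Y)"
    unfolding char_poly_def by (simp only: det_four_block_mat_symmetric)
  moreover have e: "real \<epsilon> + 1 \<noteq> 0"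
    using of_nat_0_le_iff[of \<epsilon>, where ?'a = real] by linarith
  \<comment> \<open>The factor \<open>\<epsilon> + 1\<close> of \<open>D\<close> cancels, so this
    half of the spectrum is the same for both graphs.\<close>
  moreover have "?X + ?Y = multipartite_mat n f [:-1, 1:] [:1 / s:]"
  proof -
    have "real \<epsilon> / D + 1 / D = 1 / s"
      using e by (simp add: D_def flip: add_divide_distrib)
    then show ?thesis
      by (intro eq_matI) (auto simp: multipartite_mat_def)
  qed
  \<comment> \<open>This is the origin of \<open>r\<close>, which is 0 for \<epsilon> = 1 and -1 for
    \<epsilon> = 0.\<close>
  moreover have "?X - ?Y = multipartite_mat n f [:-1, 1:] [:r / s:]"
  proof -
    have "real \<epsilon> / D - 1 / D = r / s"
      by (simp add: D_def r_def flip: diff_divide_distrib)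
    then show ?thesis
      by (intro eq_matI) (auto simp: multipartite_mat_def)
  qed
  \<comment> \<open>The case \<open>t = 1\<close> serves \<open>?X + ?Y\<close> and
    \<open>t = r\<close> serves \<open>?X - ?Y\<close>. Nonvanishing is carried along because
    splitting the roots of a product requires it to be nonzero.\<close>
  moreover have "det (multipartite_mat n f [:-1, 1:] [:t / s:]) \<noteq> 0 \<and>
      proots (det (multipartite_mat n f [:-1, 1:] [:t / s:])) =
        replicate_mset (k * m - k) 1 + replicate_mset (k - 1) (1 + t / (real k - 1)) + {# 1 - t #}"
    for t
  proof -
    have *: "of_nat m * [:t / s:] = [:t / (real k - 1):]"
      using \<open>k \<ge> 2\<close> \<open>m \<ge> 1\<close> by (simp add: of_nat_poly s_def field_simps)
    then have 1: "[:-1, 1:] - of_nat m * [:t / s:] = [:- (1 + t / (real k - 1)), 1:]"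
      by simp
    have "of_nat k - 1 = [:real k - 1:]"
      unfolding of_nat_poly one_pCons by simp
    then have "(of_nat k - 1) * of_nat m * [:t / s:] = [:t:]"
      unfolding mult.assoc * using \<open>k \<ge> 2\<close> by simp
    then have 2: "[:-1, 1:] + (of_nat k - 1) * of_nat m * [:t / s:] = [:-1 + t, 1:]"
      by simp
    have "det (multipartite_mat n f [:-1, 1:] [:t / s:])
        = [:-1, 1:] ^ (k * m - k) * [:- (1 + t / (real k - 1)), 1:] ^ (k - 1) * [:-1 + t, 1:]"
      using det_multipartite_mat[OF f f_fibre, of "[:-1, 1:]" "[:t / s:]"] \<open>k \<ge> 2\<close> \<open>m \<ge> 1\<close> n
      unfolding 1 2 by simp
    then show ?thesis
      \<comment> \<open>Multiplying out is suppressed so that the roots can be read off the linear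
        factors.\<close>
      by (simp add: proots_mult proots_power add.commute del: mult_pCons_left mult_pCons_right)
  qed
  note this[of 1] this[of r]
  moreover have "1 + 1 / (real k - 1) = real k / (real k - 1)"
    using \<open>k \<ge> 2\<close> by (simp add: field_simps)
  ultimately show ?thesis
    by (simp add: eigenvalue_mset_def proots_mult)
qed

section \<open>Specialization to \<epsilon> = 1 and \<epsilon> = 0\<close>

theorem theorem5p5:
  fixes k m :: nat and G :: "'v mixed_graph" and vs :: "'v list"
  assumes "k \<ge> 2" and "m \<ge> 1"
    and "distinct vs" and "set vs = verts G"
  shows "(is_KM k m G \<longrightarrow>
            eigenvalue_mset (norm_int_laplacian G vs) =
              {# 0 #}
              + replicate_mset (k - 1) (real k / (real k - 1))
              + replicate_mset (2 * m * k - k) 1)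
       \<and> (is_KD k m G \<longrightarrow>
            eigenvalue_mset (norm_int_laplacian G vs) =
              {# 2 #} + {# 0 #}
              + replicate_mset (k - 1) (real k / (real k - 1))
              + replicate_mset (k - 1) ((real k - 2) / (real k - 1))
              + replicate_mset (2 * k * m - 2 * k) 1)"
proof -
  define q where "q = k * m - k"
  have "k \<le> k * m"
    using \<open>m \<ge> 1\<close> by simp
  \<comment> \<open>Each determinant factor contributes the eigenvalue 1 with multiplicity
    \<open>q\<close>. If \<open>r = 0\<close>, then \<open>1 + r / (k - 1)\<close> and
    \<open>1 - r\<close> are also 1, which adds \<open>(k - 1) + 1\<close>.\<close>
  then have q: "2 * m * k - k = q + q + (k - 1) + 1" "2 * k * m - 2 * k = q + q"
    using \<open>k \<ge> 2\<close> mult.commute[of k m] unfolding q_def by linarith+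
  show ?thesis
  proof (intro conjI impI)
    assume "is_KM k m G"
    then obtain P where wf: "wf_mixed_graph G" and P: "equipartition k m (verts G) P"
      and edges: "\<And>u v. u \<in> verts G \<Longrightarrow> v \<in> verts G \<Longrightarrow>
        count (edges G) (Upair u v) = (if different_parts P u v then 1 else 0)"
      and arcs: "\<And>u v. u \<in> verts G \<Longrightarrow> v \<in> verts G \<Longrightarrow>
        count (arcs G) (u, v) = (if different_parts P u v then 1 else 0)"
      unfolding is_KM_def by blast
    show "eigenvalue_mset (norm_int_laplacian G vs) =
        {# 0 #} + replicate_mset (k - 1) (real k / (real k - 1)) + replicate_mset (2 * m * k - k) 1"
      using eigenvalue_mset_multipartite_laplacian[OF assms wf P edges arcs]
      unfolding q q_def[symmetric] by (simp add: multiset_eq_iff)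
  next
    assume "is_KD k m G"
    \<comment> \<open>The conditional with two zero branches puts the absence of edges into the form
      of the common lemma at \<epsilon> = 0.\<close>
    then obtain P where wf: "wf_mixed_graph G" and P: "equipartition k m (verts G) P"
      and edges: "\<And>u v. u \<in> verts G \<Longrightarrow> v \<in> verts G \<Longrightarrow>
        count (edges G) (Upair u v) = (if different_parts P u v then 0 else 0)"
      and arcs: "\<And>u v. u \<in> verts G \<Longrightarrow> v \<in> verts G \<Longrightarrow>
        count (arcs G) (u, v) = (if different_parts P u v then 1 else 0)"
      unfolding is_KD_def by auto
    \<comment> \<open>Here \<open>r = -1\<close>, so the second factor contributes this value
      \<open>k - 1\<close> times and \<open>1 - r = 2\<close> once.\<close>
    have "1 + (- 1) / (real k - 1) = (real k - 2) / (real k - 1)"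
      using \<open>k \<ge> 2\<close> by (simp add: field_simps)
    then show "eigenvalue_mset (norm_int_laplacian G vs) =
        {# 2 #} + {# 0 #}
        + replicate_mset (k - 1) (real k / (real k - 1))
        + replicate_mset (k - 1) ((real k - 2) / (real k - 1))
        + replicate_mset (2 * k * m - 2 * k) 1"
      using eigenvalue_mset_multipartite_laplacian[OF assms wf P edges arcs]
      unfolding q q_def[symmetric] by (simp add: multiset_eq_iff)
  qed
qed

end
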